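(* Let $a\geq1$ be an integer. The generalized sun graph $\mathcal{S}_4(a)=C_{4,1}(0,a,2a,a)$ is integral if and only if $a$ and $2a+4$ are both perfect squares, say $a=c^2$ and $2a+4=k^2$ with positive integers $c,k$, in which case it has $4a+4$ vertices and $$\sigma\bigl(\mathcal{S}_4(a)\bigr)=\Bigl\{0^{[4a-2]},\ \pm c^{[2]},\ \pm k\Bigr\}.$$ Moreover, writing $c=2c'$ and $k=2k'$, the condition $2a+4=k^2$ (with $a=c^2$) is equivalent to the classical Pell equation $$k'^2-2c'^2=1,$$ which has infinitely many solutions. Consequently there are infinitely many integral graphs of the form $\mathcal{S}_4(a)$.
   Context: A graph is integral if all eigenvalues of its adjacency matrix are integers; $\sigma(G)$ denotes the spectrum of the adjacency matrix, and $x^{[r]}$ means that the eigenvalue $x$ is listed with multiplicity $r$ (so $\pm x^{[r]}$ means that each of $x$ and $-x$ is listed with multiplicity $r$; no superscript means multiplicity $1$). For nonnegative integers $n_1,\dots,n_b$, $C_{b,1}(n_1,\dots,n_b)$ is the graph obtained from the cycle $C_b=v_1v_2\cdots v_bv_1$ by attaching $n_k$ pendant vertices to $v_k$ for $1\leq k\leq b$. *)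

theory Defs
  imports
    "Graph_Theory.Pair_Digraph"
    "Jordan_Normal_Form.Char_Poly"
    "HOL-Computational_Algebra.Nth_Powers"
begin

text \<open>
  A finite simple graph is a \<^locale>\<open>pair_graph\<close>: the arc set is a finite, irreflexive, symmetric
  relation on the vertices, so an edge \<open>uv\<close> is represented by the two arcs \<open>(u, v)\<close> and \<open>(v, u)\<close>.

  The adjacency matrix is taken over \<open>complex\<close>, so that no eigenvalue is lost by the choice of the
  field: integrality means that all complex eigenvalues are integers.
\<close>

definition adjacency_mat :: "'v list \<Rightarrow> 'v pair_pre_digraph \<Rightarrow> complex mat" where
  "adjacency_mat vs G =
     mat (length vs) (length vs) (\<lambda>(i, j). if (vs ! i, vs ! j) \<in> parcs G then 1 else 0)"

definition vertex_enum :: "'v pair_pre_digraph \<Rightarrow> 'v list" where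
  "vertex_enum G = (SOME vs. distinct vs \<and> set vs = pverts G)"

definition graph_mat :: "'v pair_pre_digraph \<Rightarrow> complex mat" where
  "graph_mat G = adjacency_mat (vertex_enum G) G"

definition graph_spectrum :: "'v pair_pre_digraph \<Rightarrow> complex multiset" where
  "graph_spectrum G = proots (char_poly (graph_mat G))"

definition integral_graph :: "'v pair_pre_digraph \<Rightarrow> bool" where
  "integral_graph G \<longleftrightarrow> (\<forall>x. eigenvalue (graph_mat G) x \<longrightarrow> x \<in> \<int>)"

text \<open>
  For \<open>ns = [n\<^sub>1, \<dots>, n\<^sub>b]\<close>, the graph \<open>C\<^bsub>b,1\<^esub>(n\<^sub>1, \<dots>, n\<^sub>b)\<close>. Indices are shifted by one: \<open>Cyc i\<close> is the cycle
  vertex \<open>v\<^bsub>i+1\<^esub>\<close>, and \<open>Pend i j\<close> with \<open>j < ns ! i\<close> are the pendant vertices attached to it. The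
  definition is meant for \<open>b \<ge> 3\<close>; otherwise \<open>C\<^sub>b\<close> is not a cycle in a simple graph.
\<close>

datatype cp_vertex = Cyc nat | Pend nat nat

inductive_set cp_arcs :: "nat list \<Rightarrow> cp_vertex rel" for ns :: "nat list" where
  cyc_fwd: "i < length ns \<Longrightarrow> (Cyc i, Cyc (Suc i mod length ns)) \<in> cp_arcs ns"
| cyc_bwd: "i < length ns \<Longrightarrow> (Cyc (Suc i mod length ns), Cyc i) \<in> cp_arcs ns"
| pend_out: "i < length ns \<Longrightarrow> j < ns ! i \<Longrightarrow> (Cyc i, Pend i j) \<in> cp_arcs ns"
| pend_in: "i < length ns \<Longrightarrow> j < ns ! i \<Longrightarrow> (Pend i j, Cyc i) \<in> cp_arcs ns"

definition cycle_pendant :: "nat list \<Rightarrow> cp_vertex pair_pre_digraph" where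
  "cycle_pendant ns =
     \<lparr> pverts = {Cyc i |i. i < length ns} \<union> {Pend i j |i j. i < length ns \<and> j < ns ! i},
       parcs = cp_arcs ns \<rparr>"

definition sun4 :: "nat \<Rightarrow> cp_vertex pair_pre_digraph" where
  "sun4 a = cycle_pendant [0, a, 2 * a, a]"

lemma finite_pverts_cycle_pendant: "finite (pverts (cycle_pendant ns))"
proof -
  have "{Pend i j |i j. i < length ns \<and> j < ns ! i}
        = (\<lambda>(i, j). Pend i j) ` (SIGMA i:{..<length ns}. {..<ns ! i})"
    by (auto simp: image_iff)
  moreover have "{Cyc i |i. i < length ns} = Cyc ` {..<length ns}"
    by auto
  ultimately show ?thesis
    by (simp add: cycle_pendant_def)
qed

lemma pair_graph_cycle_pendant:
  assumes "length ns \<ge> 3"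
  shows "pair_graph (cycle_pendant ns)"
proof -
  have arcs_verts: "u \<in> pverts (cycle_pendant ns) \<and> v \<in> pverts (cycle_pendant ns)"
    if "(u, v) \<in> cp_arcs ns" for u v
    using that by cases (use assms in \<open>auto simp: cycle_pendant_def intro!: mod_less_divisor\<close>)
  have loopfree: "u \<noteq> v" if "(u, v) \<in> cp_arcs ns" for u v
    using that assms by cases (auto simp: mod_Suc split: if_splits)
  have sym: "(v, u) \<in> cp_arcs ns" if "(u, v) \<in> cp_arcs ns" for u v
    using that by cases (auto intro: cp_arcs.intros)
  have "finite (cp_arcs ns)"
    by (rule finite_subset[of _ "pverts (cycle_pendant ns) \<times> pverts (cycle_pendant ns)"])
       (use arcs_verts finite_pverts_cycle_pendant in auto)
  moreover have "parcs (cycle_pendant ns) = cp_arcs ns"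
    by (simp add: cycle_pendant_def)
  moreover have "symmetric (with_proj (cycle_pendant ns))"
    using sym by (auto simp: symmetric_def cycle_pendant_def intro: symI)
  ultimately show ?thesis
    using finite_pverts_cycle_pendant arcs_verts loopfree by unfold_locales auto
qed

text \<open>The characteristic polynomial does not depend on the enumeration of the vertices.\<close>

lemma char_poly_adjacency_mat_cong:
  fixes vs ws :: "'v list"
  assumes "distinct vs" "distinct ws" "set vs = set ws"
  shows "char_poly (adjacency_mat vs G) = char_poly (adjacency_mat ws G)"
proof -
  let ?n = "length vs"
  have n: "length ws = ?n"
    using assms by (metis distinct_card)
  define P where "P = (\<lambda>(xs :: 'v list) ys. mat ?n ?n (\<lambda>(i, j). if xs ! i = ys ! j then 1 else 0 :: complex))"
  have delta: "(\<Sum>k = 0..<?n. (if xs ! k = y then 1 else 0) * f (xs ! k)) = (f y :: complex)"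
    if "distinct xs" "length xs = ?n" "y \<in> set xs" for xs y and f :: "'v \<Rightarrow> complex"
  proof -
    have "(\<Sum>k = 0..<?n. (if xs ! k = y then 1 else 0) * f (xs ! k))
          = (\<Sum>x\<in>set xs. (if x = y then 1 else 0) * f x)"
      using that by (intro sum.reindex_bij_betw) 
         (auto simp: bij_betw_def inj_on_def nth_eq_iff_index_eq in_set_conv_nth)
    also have "\<dots> = f y"
      using that by (simp add: if_distrib[of "\<lambda>z. z * _"] cong: if_cong)
    finally show ?thesis .
  qed
  have PP: "P xs ys * P ys xs = 1\<^sub>m ?n"
    if "distinct xs" "distinct ys" "set xs = set ys" "length xs = ?n" "length ys = ?n" for xs ys
  proof (rule eq_matI)
    fix i j assume ij: "i < dim_row (1\<^sub>m ?n :: complex mat)" "j < dim_col (1\<^sub>m ?n :: complex mat)"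
    have "(P xs ys * P ys xs) $$ (i, j)
          = (\<Sum>k = 0..<?n. (if ys ! k = xs ! i then 1 else 0) * (if ys ! k = xs ! j then 1 else 0))"
      using ij by (auto simp: P_def scalar_prod_def intro!: sum.cong)
    also have "\<dots> = (if xs ! i = xs ! j then 1 else 0)"
    proof (rule delta[of ys _ "\<lambda>y. if y = xs ! j then 1 else 0"])
      show "xs ! i \<in> set ys"
        unfolding that(3)[symmetric] by (rule nth_mem) (use that ij in simp)
    qed (fact that)+
    finally show "(P xs ys * P ys xs) $$ (i, j) = 1\<^sub>m ?n $$ (i, j)"
      using ij nth_eq_iff_index_eq[OF that(1), of i j] that(4) by simp
  qed (auto simp: P_def)
  define B where "B = adjacency_mat ws G"
  have A: "adjacency_mat vs G \<in> carrier_mat ?n ?n"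
    by (simp add: adjacency_mat_def)
  have B: "B \<in> carrier_mat ?n ?n"
    by (simp add: B_def adjacency_mat_def n)
  have P: "P xs ys \<in> carrier_mat ?n ?n" for xs ys
    by (simp add: P_def)
  define g where "g = (\<lambda>x y. if (x, y) \<in> parcs G then 1 else 0 :: complex)"
  have P_entry: "P xs ys $$ (i, j) = (if xs ! i = ys ! j then 1 else 0)"
    if "i < ?n" "j < ?n" for xs ys i j
    using that by (simp add: P_def)
  have entry: "(X * Y) $$ (i, j) = (\<Sum>k = 0..<?n. X $$ (i, k) * Y $$ (k, j))"
    if "X \<in> carrier_mat ?n ?n" "Y \<in> carrier_mat ?n ?n" "i < ?n" "j < ?n"
    for X Y :: "complex mat" and i j
    using that by (auto simp: scalar_prod_def intro!: sum.cong)
  have mem: "vs ! i \<in> set ws" if "i < ?n" for i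
    using nth_mem[OF that] assms(3) by metis
  have PB: "(P vs ws * B) $$ (i, j) = g (vs ! i) (ws ! j)" if ij: "i < ?n" "j < ?n" for i j
  proof -
    have "(P vs ws * B) $$ (i, j)
          = (\<Sum>k = 0..<?n. (if ws ! k = vs ! i then 1 else 0) * g (ws ! k) (ws ! j))"
      using ij n by (auto simp: P_def B_def adjacency_mat_def scalar_prod_def g_def intro!: sum.cong)
    also have "\<dots> = g (vs ! i) (ws ! j)"
      by (rule delta[of ws _ "\<lambda>x. g x (ws ! j)"]) (fact assms n mem[OF ij(1)])+
    finally show ?thesis .
  qed
  have "adjacency_mat vs G = P vs ws * B * P ws vs"
  proof (rule eq_matI)
    fix i j assume "i < dim_row (P vs ws * B * P ws vs)" "j < dim_col (P vs ws * B * P ws vs)"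
    hence ij: "i < ?n" "j < ?n"
      by (simp_all add: P_def)
    have "(P vs ws * B * P ws vs) $$ (i, j)
          = (\<Sum>k = 0..<?n. (P vs ws * B) $$ (i, k) * P ws vs $$ (k, j))"
      by (rule entry) (fact ij mult_carrier_mat[OF P B] P)+
    also have "\<dots> = (\<Sum>k = 0..<?n. (if ws ! k = vs ! j then 1 else 0) * g (vs ! i) (ws ! k))"
      using ij by (intro sum.cong) (auto simp: PB P_entry simp del: index_mult_mat(1))
    also have "\<dots> = g (vs ! i) (vs ! j)"
      by (rule delta[of ws _ "\<lambda>x. g (vs ! i) x"]) (fact assms n mem[OF ij(2)])+
    finally show "adjacency_mat vs G $$ (i, j) = (P vs ws * B * P ws vs) $$ (i, j)"
      using ij by (simp add: adjacency_mat_def g_def)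
  qed (auto simp: adjacency_mat_def P_def)
  moreover have "P vs ws * P ws vs = 1\<^sub>m ?n" "P ws vs * P vs ws = 1\<^sub>m ?n"
    using assms n by (auto intro!: PP)
  ultimately have "similar_mat_wit (adjacency_mat vs G) B (P vs ws) (P ws vs)"
    using A B P by (intro similar_mat_witI[of _ _ ?n])
  thus ?thesis
    unfolding B_def by (intro char_poly_similar) (auto simp: similar_mat_def)
qed

lemma char_poly_graph_mat:
  assumes "distinct vs" "set vs = pverts G"
  shows "char_poly (graph_mat G) = char_poly (adjacency_mat vs G)"
proof -
  have "distinct (vertex_enum G) \<and> set (vertex_enum G) = pverts G"
    unfolding vertex_enum_def by (rule someI[of _ vs]) (use assms in auto)
  thus ?thesis
    unfolding graph_mat_def using assms by (intro char_poly_adjacency_mat_cong) auto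
qed

end

theory Submission
  imports Defs
begin

text \<open>
  Eliminating the pendant vertices by a Schur complement, multiplied through by \<open>x\<close> to stay within
  polynomials, turns the characteristic polynomial into
  \<open>x\<^sup>m det (x\<^sup>2 I - x C - diag (n\<^sub>1, \<dots>, n\<^sub>b))\<close> up to a power of \<open>x\<close>, where \<open>C\<close> is the adjacency matrix
  of the cycle. For \<open>(0, a, 2a, a)\<close> this factors as
  \<open>x\<^bsup>4a-2\<^esup> (x\<^sup>2 - a)\<^sup>2 (x\<^sup>2 - (2a + 4))\<close>. Solutions of the Pell equation are propagated by
  \<open>(k, c) \<mapsto> (3k + 4c, 2k + 3c)\<close>, and distinct \<open>a\<close> give graphs of different order.
\<close>

section \<open>Determinants of matrices indexed by a cycle\<close>

text \<open>Laplace expansion along the first column in a form that can be iterated: each minor is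
  again \<open>mat\<close> of an explicit function, so rewriting evaluates a determinant of fixed
  size.\<close>

lemma det_mat_Suc:
  fixes f :: "nat \<times> nat \<Rightarrow> 'a :: comm_ring_1"
  shows "det (mat (Suc n) (Suc n) f) =
    (\<Sum>i<Suc n. (-1) ^ i * f (i, 0) *
       det (mat n n (\<lambda>(k, l). f (if k < i then k else Suc k, Suc l))))"
proof -
  have "mat_delete (mat (Suc n) (Suc n) f) i 0 =
      mat n n (\<lambda>(k, l). f (if k < i then k else Suc k, Suc l))" for i
    by (rule eq_matI) (auto simp: mat_delete_def)
  then show ?thesis
    by (subst laplace_expansion_column[of _ "Suc n" 0])
       (auto simp: cofactor_def mult_ac intro!: sum.cong)
qed

text \<open>In the Leibniz expansion, each edge of the 4-cycle contributes a transposition with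
  \<open>- x ^ 2\<close> times the two opposite \<open>d i\<close>; these four terms factor. The
  \<open>x ^ 4\<close> terms cancel: two disjoint pairings with sign plus, two directed 4-cycles
  with sign minus.\<close>

lemma det_cycle_four:
  fixes d :: "nat \<Rightarrow> 'a :: comm_ring_1"
  shows "det (mat 4 4 (\<lambda>(i, j). (if i = j then d i else 0)
      - (if Suc i mod 4 = j \<or> Suc j mod 4 = i then x else 0))) =
    d 0 * d 1 * d 2 * d 3 - x ^ 2 * (d 0 + d 2) * (d 1 + d 3)"
proof -
  define g where "g = (\<lambda>(i, j). (if i = j then d i else 0)
      - (if Suc i mod 4 = j \<or> Suc j mod 4 = i then x else 0))"
  have entries: "g (0, 0) = d 0" "g (0, 1) = - x" "g (0, 2) = 0" "g (0, 3) = - x"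
    "g (1, 0) = - x" "g (1, 1) = d 1" "g (1, 2) = - x" "g (1, 3) = 0"
    "g (2, 0) = 0" "g (2, 1) = - x" "g (2, 2) = d 2" "g (2, 3) = - x"
    "g (3, 0) = - x" "g (3, 1) = 0" "g (3, 2) = - x" "g (3, 3) = d 3"
    by (simp_all add: g_def)
  have four: "Suc (Suc (Suc (Suc 0))) = 4"
    by simp
  have "det (mat (Suc (Suc (Suc (Suc 0)))) (Suc (Suc (Suc (Suc 0)))) g) =
      d 0 * d 1 * d 2 * d 3 - x ^ 2 * (d 0 + d 2) * (d 1 + d 3)"
    \<comment> \<open>Iterating \<open>det_mat_Suc\<close> leaves indices in \<open>Suc\<close>
      form, so \<open>entries\<close> is converted to the same form.\<close>
    by (simp add: det_mat_Suc entries[unfolded eval_nat_numeral One_nat_def BitM.simps])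
       (simp add: eval_nat_numeral algebra_simps)
  then show ?thesis
    unfolding four g_def .
qed

section \<open>Elimination of the pendant vertices\<close>

text \<open>The zero block contributes \<open>X\<close> times the identity to the characteristic
  matrix \<open>M\<close>. Multiplying \<open>M\<close> on the right by \<open>T\<close>, with
  \<open>det T = X ^ n\<close>, eliminates the lower left block without dividing by
  \<open>X\<close>; comparing determinants gives the claim.\<close>

lemma char_poly_bordered_mat:
  fixes C N :: "'a :: idom mat"
  assumes C: "C \<in> carrier_mat n n" and N: "N \<in> carrier_mat n m"
  shows "[:0, 1:] ^ n * char_poly (four_block_mat C N (transpose_mat N) (0\<^sub>m m m)) =
    [:0, 1:] ^ m * det (mat n n (\<lambda>(i, j). (if i = j then [:0, 0, 1:] else 0)
      - [:0, C $$ (i, j):] - [:(N * transpose_mat N) $$ (i, j):]))"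
proof -
  define X :: "'a poly" where "X = [:0, 1:]"
  define P where "P = char_poly_matrix C"
  define Q where "Q = map_mat (\<lambda>a. [:- a:]) N"
  define N' where "N' = map_mat (\<lambda>a. [:a:]) (transpose_mat N)"
  define R where "R = map_mat (\<lambda>a. [:- a:]) (transpose_mat N)"
  define M where "M = char_poly_matrix (four_block_mat C N (transpose_mat N) (0\<^sub>m m m))"
  \<comment> \<open>\<open>M T\<close> is block upper triangular with the scaled Schur complement \<open>D\<close> in the upper left corner.\<close>
  define T where "T = four_block_mat (X \<cdot>\<^sub>m 1\<^sub>m n) (0\<^sub>m n m) N' (1\<^sub>m m)"
  define D where "D = P * (X \<cdot>\<^sub>m 1\<^sub>m n) + Q * N'"
  have carrier: "P \<in> carrier_mat n n" "Q \<in> carrier_mat n m" "N' \<in> carrier_mat m n"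
      "R \<in> carrier_mat m n"
    using C N by (auto simp: P_def Q_def N'_def R_def)
  have D: "D = mat n n (\<lambda>(i, j). (if i = j then [:0, 0, 1:] else 0)
      - [:0, C $$ (i, j):] - [:(N * transpose_mat N) $$ (i, j):])"
  proof (rule eq_matI)
    fix i j assume "i < dim_row (mat n n (\<lambda>(i, j). (if i = j then [:0, 0, 1:] else 0)
      - [:0, C $$ (i, j):] - [:(N * transpose_mat N) $$ (i, j):]))"
      "j < dim_col (mat n n (\<lambda>(i, j). (if i = j then [:0, 0, 1:] else 0)
      - [:0, C $$ (i, j):] - [:(N * transpose_mat N) $$ (i, j):]))"
    then have ij: "i < n" "j < n" by auto
    have "(Q * N') $$ (i, j) = - [:(N * transpose_mat N) $$ (i, j):]"
    proof -
      have "(Q * N') $$ (i, j) = (\<Sum>k = 0..<m. [:- (N $$ (i, k) * N $$ (j, k)):])"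
        using ij N by (auto simp: Q_def N'_def scalar_prod_def mult.commute intro!: sum.cong)
      also have "\<dots> = [:\<Sum>k = 0..<m. - (N $$ (i, k) * N $$ (j, k)):]"
        by (rule poly_eqI) (simp add: coeff_sum coeff_pCons split: nat.splits)
      also have "\<dots> = - [:(N * transpose_mat N) $$ (i, j):]"
        using ij N by (auto simp: scalar_prod_def sum_negf)
      finally show ?thesis .
    qed
    moreover have "P * (X \<cdot>\<^sub>m 1\<^sub>m n) = X \<cdot>\<^sub>m P"
      using carrier by (simp add: mult_smult_distrib[of _ n n _ n])
    ultimately show "D $$ (i, j) = mat n n (\<lambda>(i, j). (if i = j then [:0, 0, 1:] else 0)
      - [:0, C $$ (i, j):] - [:(N * transpose_mat N) $$ (i, j):]) $$ (i, j)"
      using ij C N carrier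
      by (auto simp: D_def P_def X_def char_poly_matrix_def simp del: index_mult_mat(1))
  qed (use carrier in \<open>auto simp: D_def\<close>)
  have M: "M = four_block_mat P Q R (X \<cdot>\<^sub>m 1\<^sub>m m)"
    using C N by (intro eq_matI) (auto simp: M_def P_def Q_def R_def X_def char_poly_matrix_def)
  have "R * (X \<cdot>\<^sub>m 1\<^sub>m n) = X \<cdot>\<^sub>m R" "X \<cdot>\<^sub>m 1\<^sub>m m * N' = X \<cdot>\<^sub>m N'"
    using carrier by (simp_all add: mult_smult_distrib[of _ m n _ n] mult_smult_assoc_mat[of _ m m _ n])
  \<comment> \<open>The entries of \<open>N'\<close> are the negatives of those of \<open>R\<close>,
    which is what makes the lower left block of \<open>M * T\<close> vanish.\<close>
  moreover have "X \<cdot>\<^sub>m R + X \<cdot>\<^sub>m N' = 0\<^sub>m m n"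
    using N by (intro eq_matI) (auto simp: R_def N'_def X_def)
  ultimately have "R * (X \<cdot>\<^sub>m 1\<^sub>m n) + X \<cdot>\<^sub>m 1\<^sub>m m * N' = 0\<^sub>m m n"
    by simp
  moreover have "P * 0\<^sub>m n m + Q * 1\<^sub>m m = Q" "R * 0\<^sub>m n m + X \<cdot>\<^sub>m 1\<^sub>m m * 1\<^sub>m m = X \<cdot>\<^sub>m 1\<^sub>m m"
    using carrier by auto
  ultimately have "M * T = four_block_mat D Q (0\<^sub>m m n) (X \<cdot>\<^sub>m 1\<^sub>m m)"
    unfolding M T_def D_def using carrier
    by (subst mult_four_block_mat[of _ n n _ m _ m _ _ n _ m])
       auto
  moreover have "D \<in> carrier_mat n n"
    using carrier by (simp add: D_def)
  ultimately have "det (M * T) = det D * X ^ m"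
    using carrier by (simp add: det_four_block_mat_lower_left_zero[of _ n _ m])
  moreover have "det (M * T) = det M * det T"
    using carrier by (intro det_mult[of _ "n + m"]) (auto simp: M T_def)
  moreover have "det T = X ^ n"
    unfolding T_def using carrier
    by (subst det_four_block_mat_upper_right_zero[of _ n _ m]) auto
  ultimately show ?thesis
    by (simp add: char_poly_def D X_def M_def mult_ac)
qed

text \<open>Listing the cycle vertices before the pendant ones makes the adjacency matrix bordered,
  with \<open>N\<close> recording which cycle vertex carries which pendant. Since every pendant has
  only one neighbour, \<open>N * transpose_mat N\<close> is the diagonal matrix of
  \<open>ns\<close>.\<close>

lemma char_poly_cycle_pendant:
  fixes ns :: "nat list"
  defines "n \<equiv> length ns" and "m \<equiv> sum_list ns"
  shows "[:0, 1:] ^ n * char_poly (graph_mat (cycle_pendant ns)) =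
    [:0, 1:] ^ m * det (mat n n (\<lambda>(i, j). (if i = j then [:- of_nat (ns ! i), 0, 1:] else 0)
      - (if Suc i mod n = j \<or> Suc j mod n = i then [:0, 1:] else 0)))"
    and "card (pverts (cycle_pendant ns)) = n + m"
proof -
  define I where "I = (SIGMA i:{..<n}. {..<ns ! i})"
  have I: "finite I" by (simp add: I_def)
  have cardI: "card I = m"
    by (simp add: I_def m_def n_def sum_list_sum_nth lessThan_atLeast0)
  obtain ps where ps: "distinct ps" "set ps = I"
    using finite_distinct_list[OF I] by blast
  have len: "length ps = m"
    using distinct_card[OF ps(1)] ps(2) cardI by simp
  define vs where "vs = map Cyc [0..<n] @ map (\<lambda>(i, j). Pend i j) ps"
  have vs: "distinct vs" "set vs = pverts (cycle_pendant ns)"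
    using ps by (auto simp: vs_def distinct_map inj_on_def cycle_pendant_def I_def n_def image_iff)
  show "card (pverts (cycle_pendant ns)) = n + m"
    using distinct_card[OF vs(1)] vs(2) by (simp add: vs_def len)
  define C :: "complex mat" where
    "C = mat n n (\<lambda>(i, j). if Suc i mod n = j \<or> Suc j mod n = i then 1 else 0)"
  define N :: "complex mat" where
    "N = mat n m (\<lambda>(i, k). if fst (ps ! k) = i then 1 else 0)"
  have arcs_Cyc: "(Cyc i, Cyc j) \<in> cp_arcs ns \<longleftrightarrow> Suc i mod n = j \<or> Suc j mod n = i"
    if "i < n" "j < n" for i j
    using that by (auto simp: n_def elim!: cp_arcs.cases intro: cp_arcs.intros)
  have arcs_Pend: "(Cyc i, Pend j k) \<in> cp_arcs ns \<longleftrightarrow> i = j"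
    "(Pend j k, Cyc i) \<in> cp_arcs ns \<longleftrightarrow> i = j" if "(j, k) \<in> I" for i j k
    using that by (auto simp: n_def I_def elim!: cp_arcs.cases intro: cp_arcs.intros)
  have arcs_Pend2: "(Pend i l, Pend j k) \<notin> cp_arcs ns" for i j k l
    by (auto elim!: cp_arcs.cases)
  have psI: "ps ! k \<in> I" if "k < m" for k
    using that ps len nth_mem by metis
  have adj: "adjacency_mat vs (cycle_pendant ns) = four_block_mat C N (transpose_mat N) (0\<^sub>m m m)"
  proof (rule eq_matI)
    fix i j assume "i < dim_row (four_block_mat C N (transpose_mat N) (0\<^sub>m m m))"
      "j < dim_col (four_block_mat C N (transpose_mat N) (0\<^sub>m m m))"
    then have ij: "i < n + m" "j < n + m" by (auto simp: C_def)
    have lower: "vs ! k = Pend (fst (ps ! (k - n))) (snd (ps ! (k - n)))"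
        "(fst (ps ! (k - n)), snd (ps ! (k - n))) \<in> I"
      if "\<not> k < n" "k < n + m" for k
      using that psI[of "k - n"] by (auto simp: vs_def nth_append len case_prod_beta)
    have upper: "vs ! k = Cyc k" if "k < n" for k
      using that by (simp add: vs_def nth_append)
    have "length vs = n + m" by (simp add: vs_def len)
    then show "adjacency_mat vs (cycle_pendant ns) $$ (i, j) =
        four_block_mat C N (transpose_mat N) (0\<^sub>m m m) $$ (i, j)"
      using ij lower[of i] lower[of j]
      by (cases "i < n"; cases "j < n")
         (auto simp: adjacency_mat_def cycle_pendant_def C_def N_def upper arcs_Cyc arcs_Pend
           arcs_Pend2)
  qed (auto simp: adjacency_mat_def vs_def len C_def)
  \<comment> \<open>The entry counts the pendant vertices adjacent to both cycle vertices
    \<open>i\<close> and \<open>j\<close>.\<close>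
  have NN: "(N * transpose_mat N) $$ (i, j) = (if i = j then of_nat (ns ! i) else 0)"
    if "i < n" "j < n" for i j
  proof -
    have "(N * transpose_mat N) $$ (i, j) =
        (\<Sum>k = 0..<m. (\<lambda>p. if fst p = i \<and> fst p = j then 1 else 0) (ps ! k))"
      using that by (auto simp: N_def scalar_prod_def intro!: sum.cong)
    also have "\<dots> = (\<Sum>p\<in>I. if fst p = i \<and> fst p = j then 1 else 0)"
      by (rule sum.reindex_bij_betw)
         (use bij_betw_nth[OF ps(1), of "{..<m}"] ps(2) len in \<open>simp add: lessThan_atLeast0\<close>)
    also have "\<dots> = of_nat (card {p \<in> I. fst p = i \<and> fst p = j})"
      using I by (simp add: sum.If_cases Int_def)
    also have "{p \<in> I. fst p = i \<and> fst p = j} = (if i = j then Pair i ` {..<ns ! i} else {})"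
      using that by (auto simp: I_def)
    finally show ?thesis
      by (simp add: card_image inj_on_def)
  qed
  have "C \<in> carrier_mat n n" "N \<in> carrier_mat n m"
    by (simp_all add: C_def N_def)
  note char_poly_bordered_mat[OF this]
  also have "mat n n (\<lambda>(i, j). (if i = j then [:0, 0, 1:] else 0)
      - [:0, C $$ (i, j):] - [:(N * transpose_mat N) $$ (i, j):]) =
    mat n n (\<lambda>(i, j). (if i = j then [:- of_nat (ns ! i), 0, 1:] else 0)
      - (if Suc i mod n = j \<or> Suc j mod n = i then [:0, 1:] else 0))"
    by (rule eq_matI) (auto simp: NN C_def simp del: index_mult_mat)
  finally show "[:0, 1:] ^ n * char_poly (graph_mat (cycle_pendant ns)) =
    [:0, 1:] ^ m * det (mat n n (\<lambda>(i, j). (if i = j then [:- of_nat (ns ! i), 0, 1:] else 0)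
      - (if Suc i mod n = j \<or> Suc j mod n = i then [:0, 1:] else 0)))"
    using char_poly_graph_mat[OF vs] adj by simp
qed

section \<open>Characteristic polynomial and spectrum of the sun graph\<close>

lemma card_pverts_sun4: "card (pverts (sun4 a)) = 4 * a + 4"
  using char_poly_cycle_pendant(2)[of "[0, a, 2 * a, a]"] by (simp add: sun4_def)

text \<open>The values \<open>2 * a\<close> and \<open>0\<close> on opposite cycle vertices make
  both sums in \<open>det_cycle_four\<close> equal to 2(x^2 - a), so (x^2 - a)^2 splits off the
  determinant; what remains is x^2 (x^2 - 2a - 4).\<close>

lemma char_poly_sun4:
  assumes "a \<ge> 1"
  shows "char_poly (graph_mat (sun4 a)) =
    [:0, 1:] ^ (4 * a - 2) * [:- of_nat a, 0, 1:] ^ 2 * [:- of_nat (2 * a + 4), 0, 1:]"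
proof -
  define X :: "complex poly" where "X = [:0, 1:]"
  define A :: "complex poly" where "A = of_nat a"
  have quad: "[:- of_nat b, 0, 1:] = X ^ 2 - of_nat b" for b
    by (simp add: X_def power2_eq_square of_nat_poly)
  have len: "length [0, a, 2 * a, a] = 4" and sum: "sum_list [0, a, 2 * a, a] = 4 * a"
    by simp_all
  have "X ^ 4 * char_poly (graph_mat (sun4 a)) =
    X ^ (4 * a) * det (mat 4 4 (\<lambda>(i, j). (if i = j then X ^ 2 - of_nat ([0, a, 2 * a, a] ! i) else 0)
      - (if Suc i mod 4 = j \<or> Suc j mod 4 = i then X else 0)))"
    using char_poly_cycle_pendant(1)[of "[0, a, 2 * a, a]"]
    unfolding len sum quad unfolding X_def[symmetric] sun4_def[symmetric] .
  also have "det (mat 4 4 (\<lambda>(i, j). (if i = j then X ^ 2 - of_nat ([0, a, 2 * a, a] ! i) else 0)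
      - (if Suc i mod 4 = j \<or> Suc j mod 4 = i then X else 0))) =
    X ^ 2 * ((X ^ 2 - A) ^ 2 * (X ^ 2 - (2 * A + 4)))"
    unfolding det_cycle_four
    by (simp add: A_def) (simp add: power2_eq_square algebra_simps)
  also have "X ^ (4 * a) * (X ^ 2 * ((X ^ 2 - A) ^ 2 * (X ^ 2 - (2 * A + 4)))) =
    X ^ (4 * a + 2) * ((X ^ 2 - A) ^ 2 * (X ^ 2 - (2 * A + 4)))"
    by (simp only: power_add mult.assoc)
  \<comment> \<open>Here \<open>a \<ge> 1\<close> keeps the subtraction from truncating; the
    split-off fourth power cancels against the left-hand side.\<close>
  also have "4 * a + 2 = 4 + (4 * a - 2)"
    using assms by simp
  finally have "X ^ 4 * char_poly (graph_mat (sun4 a)) =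
    X ^ 4 * (X ^ (4 * a - 2) * (X ^ 2 - A) ^ 2 * (X ^ 2 - (2 * A + 4)))"
    by (simp only: power_add mult.assoc)
  moreover have "X \<noteq> 0"
    by (simp add: X_def)
  ultimately show ?thesis
    unfolding quad unfolding X_def[symmetric] by (simp add: A_def)
qed

lemma all_Ints_square_eq_of_nat_iff:
  "(\<forall>x::complex. x ^ 2 = of_nat n \<longrightarrow> x \<in> \<int>) \<longleftrightarrow> is_square n"
proof
  assume "\<forall>x::complex. x ^ 2 = of_nat n \<longrightarrow> x \<in> \<int>"
  \<comment> \<open>One complex root suffices: if it is an integer \<open>z\<close>, then
    \<open>n\<close> is the square of its absolute value.\<close>
  then have "csqrt (of_nat n) \<in> \<int>" by (metis power2_csqrt)
  then obtain z where "csqrt (of_nat n) = of_int z" by (auto elim: Ints_cases)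
  then have "(of_int z :: complex) ^ 2 = of_nat n" by (metis power2_csqrt)
  then have "z ^ 2 = int n"
    by (metis of_int_eq_iff of_int_of_nat_eq of_int_power)
  then have "n = nat \<bar>z\<bar> ^ 2"
    by (metis nat_int nat_power_eq abs_ge_zero power2_abs)
  then show "is_square n" by auto
next
  assume "is_square n"
  then obtain m where m: "n = m ^ 2" by (auto elim: is_nth_powerE)
  show "\<forall>x::complex. x ^ 2 = of_nat n \<longrightarrow> x \<in> \<int>"
    by (auto simp: m power2_eq_iff)
qed

lemma integral_graph_sun4_iff:
  assumes "a \<ge> 1"
  shows "integral_graph (sun4 a) \<longleftrightarrow> is_square a \<and> is_square (2 * a + 4)"
proof -
  have carrier: "graph_mat (sun4 a) \<in>
      carrier_mat (length (vertex_enum (sun4 a))) (length (vertex_enum (sun4 a)))"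
    by (simp add: graph_mat_def adjacency_mat_def)
  have quad: "poly [:- of_nat b, 0, 1:] x = x ^ 2 - of_nat b" for b and x :: complex
    by (simp add: power2_eq_square)
  \<comment> \<open>Since \<open>a \<ge> 1\<close>, the exponent \<open>4 * a - 2\<close> is
    positive and 0 is a root; being an integer, it puts no condition on \<open>a\<close>.\<close>
  have "eigenvalue (graph_mat (sun4 a)) x \<longleftrightarrow>
      x = 0 \<or> x ^ 2 = of_nat a \<or> x ^ 2 = of_nat (2 * a + 4)" for x
    unfolding eigenvalue_root_char_poly[OF carrier] char_poly_sun4[OF assms] poly_mult poly_power quad
    using assms by simp
  then have "integral_graph (sun4 a) \<longleftrightarrow>
      (\<forall>x::complex. x ^ 2 = of_nat a \<longrightarrow> x \<in> \<int>) \<and>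
      (\<forall>x::complex. x ^ 2 = of_nat (2 * a + 4) \<longrightarrow> x \<in> \<int>)"
    unfolding integral_graph_def by (metis Ints_0)
  then show ?thesis
    by (simp only: all_Ints_square_eq_of_nat_iff)
qed

text \<open>Parametrizing by \<open>c\<close> and \<open>k\<close> turns both quadratic factors into
  differences of squares, so the characteristic polynomial is a product of linear factors and its
  root multiset can be read off.\<close>

lemma graph_spectrum_sun4:
  assumes "c > 0" "k > 0" "2 * c ^ 2 + 4 = k ^ 2"
  shows "graph_spectrum (sun4 (c ^ 2)) =
    replicate_mset (4 * c ^ 2 - 2) 0 +
    replicate_mset 2 (of_nat c) + replicate_mset 2 (- of_nat c) +
    {# of_nat k, - of_nat k #}"
proof -
  have quad: "[:- of_nat (b ^ 2), 0, 1:] = [:- of_nat b, 1:] * [:of_nat b, 1 :: complex:]" for b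
    by (simp add: power2_eq_square)
  have "c ^ 2 \<ge> 1" using assms by simp
  have repeat: "repeat_mset n {#x#} = replicate_mset n x" for n and x :: complex
    by (rule multiset_eqI) simp
  show ?thesis
    unfolding graph_spectrum_def char_poly_sun4[OF \<open>c ^ 2 \<ge> 1\<close>] assms(3) quad
    \<comment> \<open>The deleted rules would multiply the linear factors out again.\<close>
    by (simp add: proots_mult proots_power repeat del: mult_pCons_left mult_pCons_right)
qed

section \<open>The Pell equation\<close>

text \<open>Parity forces the halving: \<open>k ^ 2\<close> is even, and after writing
  \<open>k = 2 * k'\<close> so is \<open>c ^ 2\<close>; dividing by 4 leaves the Pell equation. It
  is stated over \<open>int\<close> because subtraction on \<open>nat\<close> truncates.\<close>

lemma square_eq_Pell_iff:
  fixes c k :: nat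
  shows "2 * c ^ 2 + 4 = k ^ 2 \<longleftrightarrow>
    (\<exists>c' k'. c = 2 * c' \<and> k = 2 * k' \<and> (int k') ^ 2 - 2 * (int c') ^ 2 = 1)"
proof
  assume eq: "2 * c ^ 2 + 4 = k ^ 2"
  then have "even (k ^ 2)" by (metis dvd_add dvd_triv_left even_numeral)
  then obtain k' where k': "k = 2 * k'" by (auto elim: evenE)
  with eq have eq': "c ^ 2 + 2 = 2 * k' ^ 2" by (simp add: power_mult_distrib)
  then have "even (c ^ 2)" by presburger
  then obtain c' where c': "c = 2 * c'" by (auto elim: evenE)
  from eq' have "2 * c' ^ 2 + 1 = k' ^ 2" by (simp add: c' power_mult_distrib)
  then have "int (2 * c' ^ 2 + 1) = int (k' ^ 2)" by (simp only:)
  then show "\<exists>c' k'. c = 2 * c' \<and> k = 2 * k' \<and> (int k') ^ 2 - 2 * (int c') ^ 2 = 1"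
    using c' k' by (intro exI[of _ c'] exI[of _ k']) simp
next
  assume "\<exists>c' k'. c = 2 * c' \<and> k = 2 * k' \<and> (int k') ^ 2 - 2 * (int c') ^ 2 = 1"
  then obtain c' k' where *: "c = 2 * c'" "k = 2 * k'" "(int k') ^ 2 - 2 * (int c') ^ 2 = 1"
    by blast
  then have "int (2 * c ^ 2 + 4) = int (k ^ 2)" by (simp add: power_mult_distrib)
  then show "2 * c ^ 2 + 4 = k ^ 2" by (simp only: of_nat_eq_iff)
qed

text \<open>Solutions with arbitrarily large \<open>c\<close> exist by induction. Stating this for
  the second component alone serves both infinitude claims: the solution pairs project onto this
  set, and the graphs are indexed by it.\<close>

lemma infinite_Pell_snd:
  "infinite {c :: nat. c > 0 \<and> (\<exists>k > 0. (int k) ^ 2 - 2 * (int c) ^ 2 = 1)}"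
proof -
  have "\<exists>c > m. \<exists>k > 0. (int k) ^ 2 - 2 * (int c) ^ 2 = 1" for m
  proof (induction m)
    case 0
    \<comment> \<open>The fundamental solution: 3^2 - 2 * 2^2 = 1.\<close>
    show ?case by (intro exI[of _ 2] conjI exI[of _ 3]) auto
  next
    case (Suc m)
    then obtain c k where ck: "c > m" "k > 0" "(int k) ^ 2 - 2 * (int c) ^ 2 = 1" by blast
    \<comment> \<open>Multiplication of k + c sqrt 2 by the unit 3 + 2 sqrt 2 of norm 1, which
      preserves the norm.\<close>
    have "(int (3 * k + 4 * c)) ^ 2 - 2 * (int (2 * k + 3 * c)) ^ 2 = 1"
      using ck(3) by (simp add: power2_eq_square algebra_simps)
    then show ?case
      using ck(1,2) by (intro exI[of _ "2 * k + 3 * c"] conjI exI[of _ "3 * k + 4 * c"]) auto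
  qed
  then show ?thesis
    unfolding infinite_nat_iff_unbounded by (metis (mono_tags, lifting) gr_zeroI mem_Collect_eq not_less_zero)
qed

theorem theorem3p12:
  shows "(\<forall>a::nat. a \<ge> 1 \<longrightarrow>
            (integral_graph (sun4 a) \<longleftrightarrow> is_square a \<and> is_square (2 * a + 4)) \<and>
            (\<forall>c k :: nat. c > 0 \<and> k > 0 \<and> a = c ^ 2 \<and> 2 * a + 4 = k ^ 2 \<longrightarrow>
               card (pverts (sun4 a)) = 4 * a + 4 \<and>
               graph_spectrum (sun4 a) =
                 replicate_mset (4 * a - 2) 0 +
                 replicate_mset 2 (of_nat c) + replicate_mset 2 (- of_nat c) +
                 {# of_nat k, - of_nat k #})) \<and>
         (\<forall>a c k :: nat. a \<ge> 1 \<and> c > 0 \<and> k > 0 \<and> a = c ^ 2 \<longrightarrow>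
            (2 * a + 4 = k ^ 2 \<longleftrightarrow>
              (\<exists>c' k' :: nat. c = 2 * c' \<and> k = 2 * k' \<and> (int k') ^ 2 - 2 * (int c') ^ 2 = 1))) \<and>
         infinite {(k' :: nat, c' :: nat). k' > 0 \<and> c' > 0 \<and> (int k') ^ 2 - 2 * (int c') ^ 2 = 1} \<and>
         infinite {sun4 a | a. a \<ge> 1 \<and> integral_graph (sun4 a)}"
proof (intro conjI allI impI)
  fix a :: nat assume "a \<ge> 1"
  then show "integral_graph (sun4 a) \<longleftrightarrow> is_square a \<and> is_square (2 * a + 4)"
    by (rule integral_graph_sun4_iff)
next
  fix a show "card (pverts (sun4 a)) = 4 * a + 4"
    by (rule card_pverts_sun4)
next
  fix a c k :: nat
  assume "c > 0 \<and> k > 0 \<and> a = c ^ 2 \<and> 2 * a + 4 = k ^ 2"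
  then show "graph_spectrum (sun4 a) = replicate_mset (4 * a - 2) 0 +
      replicate_mset 2 (of_nat c) + replicate_mset 2 (- of_nat c) + {# of_nat k, - of_nat k #}"
    using graph_spectrum_sun4[of c k] by simp
next
  fix a c k :: nat
  assume "a \<ge> 1 \<and> c > 0 \<and> k > 0 \<and> a = c ^ 2"
  then show "2 * a + 4 = k ^ 2 \<longleftrightarrow>
      (\<exists>c' k' :: nat. c = 2 * c' \<and> k = 2 * k' \<and> (int k') ^ 2 - 2 * (int c') ^ 2 = 1)"
    using square_eq_Pell_iff[of c k] by simp
next
  let ?S = "{c :: nat. c > 0 \<and> (\<exists>k > 0. (int k) ^ 2 - 2 * (int c) ^ 2 = 1)}"
  have "?S = snd ` {(k' :: nat, c' :: nat). k' > 0 \<and> c' > 0 \<and> (int k') ^ 2 - 2 * (int c') ^ 2 = 1}"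
    by force
  then show "infinite {(k' :: nat, c' :: nat). k' > 0 \<and> c' > 0 \<and> (int k') ^ 2 - 2 * (int c') ^ 2 = 1}"
    using infinite_Pell_snd by (metis (no_types, lifting) finite_imageI)
  \<comment> \<open>A Pell solution \<open>(k, c)\<close> corresponds to
    \<open>a = (2 * c) ^ 2\<close>, which the number of vertices recovers.\<close>
  have "inj_on (\<lambda>c. sun4 ((2 * c) ^ 2)) ?S"
  proof (rule inj_onI)
    fix c d :: nat assume "sun4 ((2 * c) ^ 2) = sun4 ((2 * d) ^ 2)"
    then have "4 * (2 * c) ^ 2 + 4 = 4 * (2 * d) ^ 2 + 4"
      by (metis card_pverts_sun4)
    then show "c = d" by (simp add: power_mult_distrib)
  qed
  then have "infinite ((\<lambda>c. sun4 ((2 * c) ^ 2)) ` ?S)"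
    using infinite_Pell_snd finite_imageD by blast
  moreover have "(\<lambda>c. sun4 ((2 * c) ^ 2)) ` ?S \<subseteq> {sun4 a | a. a \<ge> 1 \<and> integral_graph (sun4 a)}"
  proof safe
    fix c k :: nat assume ck: "c > 0" "(int k) ^ 2 - 2 * (int c) ^ 2 = 1"
    \<comment> \<open>The Pell equation read backwards, with \<open>2 * k\<close> as the root of
      \<open>2 * a + 4\<close>.\<close>
    then have "2 * (2 * c) ^ 2 + 4 = (2 * k) ^ 2"
      unfolding square_eq_Pell_iff by blast
    then have "is_square (2 * (2 * c) ^ 2 + 4)" by (metis is_nth_power_nth_power)
    then have "integral_graph (sun4 ((2 * c) ^ 2))"
      using ck(1) integral_graph_sun4_iff[of "(2 * c) ^ 2"] is_nth_power_nth_power[of 2 "2 * c"]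
      by simp
    with ck(1) show "\<exists>a. sun4 ((2 * c) ^ 2) = sun4 a \<and> a \<ge> 1 \<and> integral_graph (sun4 a)"
      by (intro exI[of _ "(2 * c) ^ 2"]) simp
  qed
  ultimately show "infinite {sun4 a | a. a \<ge> 1 \<and> integral_graph (sun4 a)}"
    by (rule infinite_super[rotated])
qed

end
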